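(* For every positive integer $n$ and for every symmetric convex body $K\subset\mathbb{R}^n$, there is $U\in \mathrm{SO}(n)$ such that the inequality $$\frac{\operatorname{diam} Q_{k-1}(UK)}{\operatorname{diam} Q_k(UK)}\leq 3$$ holds for every $k\in\{2,\dots,n\}$, where the diameters may be taken with respect to any norm on $\mathbb{R}^n$ (the same norm in numerator and denominator).
   Context: A convex body in $\mathbb{R}^n$ is a compact convex subset of $\mathbb{R}^n$ with nonempty interior; it is symmetric if $K=-K$. Let $\{e_1,\dots,e_n\}$ be the standard basis of $\mathbb{R}^n$. For $S\subseteq\{1,\dots,n\}$ let $P_S:\mathbb{R}^n\to\mathbb{R}^n$ be the orthogonal projection onto the subspace spanned by $\{e_j : j\in S\}$. For $k\in\{1,\dots,n\}$ let $[n]_k$ be the family of all subsets $S\subseteq\{1,\dots,n\}$ of cardinality $k$. For a convex body $K\subset\mathbb{R}^n$ and $k\in\{1,\dots,n\}$, the $k$-convex hull of $K$ is $$Q_k(K)=\bigcap_{S\in[n]_k}P_S^{-1}\bigl(P_S(K)\bigr).$$ Here $P_S^{-1}$ denotes preimage and $UK=\{Ux: x\in K\}$. The diameter of a set $A$ with respect to a norm $N$ is $\sup\{N(x-y): x,y\in A\}$. The rotation $U$ does not depend on the choice of norm. *)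

theory Defs
  imports "HOL-Analysis.Analysis"
begin

text \<open>
  The space \<open>\<real>\<^sup>n\<close> is \<^typ>\<open>real ^ 'n\<close> with \<open>n = CARD('n)\<close>; the coordinates are indexed by the finite
  type \<^typ>\<open>'n\<close> instead of \<open>{1, \<dots>, n}\<close>, and \<open>e\<^sub>j\<close> is \<open>axis j 1\<close>.
\<close>

definition convex_body :: "(real ^ 'n) set \<Rightarrow> bool" where
  "convex_body K \<longleftrightarrow> compact K \<and> convex K \<and> interior K \<noteq> {}"

definition symmetric_set :: "(real ^ 'n) set \<Rightarrow> bool" where
  "symmetric_set K \<longleftrightarrow> K = uminus ` K"

definition orth_proj :: "(real ^ 'n) set \<Rightarrow> real ^ 'n \<Rightarrow> real ^ 'n" where
  "orth_proj V x = (THE y. y \<in> V \<and> (\<forall>v\<in>V. orthogonal (x - y) v))"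

definition coord_proj :: "'n set \<Rightarrow> real ^ 'n \<Rightarrow> real ^ 'n" where
  "coord_proj S = orth_proj (span ((\<lambda>j. axis j 1) ` S))"

definition k_convex_hull :: "nat \<Rightarrow> (real ^ 'n) set \<Rightarrow> (real ^ 'n) set" where
  "k_convex_hull k K = (\<Inter>S\<in>{S. card S = k}. coord_proj S -` (coord_proj S ` K))"

definition is_norm :: "(real ^ 'n \<Rightarrow> real) \<Rightarrow> bool" where
  "is_norm N \<longleftrightarrow>
     (\<forall>x. 0 \<le> N x) \<and> (\<forall>x. N x = 0 \<longleftrightarrow> x = 0) \<and>
     (\<forall>c x. N (c *\<^sub>R x) = \<bar>c\<bar> * N x) \<and> (\<forall>x y. N (x + y) \<le> N x + N y)"

text \<open>
  The supremum is taken in \<^typ>\<open>real\<close>, so this is meaningful only for nonempty bounded \<open>A\<close>.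
  For a convex body \<open>K\<close> and \<open>1 \<le> k \<le> n\<close>, the set \<open>k_convex_hull k K\<close> is of this kind: it contains
  \<open>K\<close> and is contained in the smallest coordinate box around \<open>K\<close>.
\<close>

definition norm_diameter :: "(real ^ 'n \<Rightarrow> real) \<Rightarrow> (real ^ 'n) set \<Rightarrow> real" where
  "norm_diameter N A = Sup {N (x - y) |x y. x \<in> A \<and> y \<in> A}"

lemma orth_proj_eqI:
  assumes V: "subspace V" and y: "y \<in> V" and orth: "\<And>v. v \<in> V \<Longrightarrow> orthogonal (x - y) v"
  shows "orth_proj V x = y"
  unfolding orth_proj_def
proof (rule the_equality)
  show "y \<in> V \<and> (\<forall>v\<in>V. orthogonal (x - y) v)"
    using y orth by blast
next
  fix z assume z: "z \<in> V \<and> (\<forall>v\<in>V. orthogonal (x - z) v)"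
  have "z - y \<in> V"
    using V y z by (simp add: subspace_diff)
  then have "(x - y) \<bullet> (z - y) = 0" "(x - z) \<bullet> (z - y) = 0"
    using orth z by (auto simp: orthogonal_def)
  then have "(z - y) \<bullet> (z - y) = 0"
    by (simp add: inner_diff_left)
  then show "z = y"
    by simp
qed

lemma coord_proj_eq: "coord_proj S x = (\<chi> i. if i \<in> S then x $ i else 0)"
  unfolding coord_proj_def
proof (rule orth_proj_eqI)
  let ?y = "\<chi> i. if i \<in> S then x $ i else 0"
  show "subspace (span ((\<lambda>j. axis j 1) ` S) :: (real ^ 'a) set)"
    by simp
  have eq: "?y = (\<Sum>j\<in>S. x $ j *\<^sub>R axis j 1)"
    by (simp add: vec_eq_iff axis_def if_distrib cong: if_cong)
  show "?y \<in> span ((\<lambda>j. axis j 1) ` S)"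
    unfolding eq by (intro span_sum span_scale span_base imageI)
  fix v assume "v \<in> span ((\<lambda>j. axis j 1) ` S :: (real ^ 'a) set)"
  then show "orthogonal (x - ?y) v"
    by (rule orthogonal_to_span) (auto simp: orthogonal_def inner_axis)
qed

end

theory Submission
  imports Defs
begin

text \<open>
  The inclusion \<open>Q\<^bsub>k-1\<^esub>(UK) \<subseteq> 3 Q\<^sub>k(UK)\<close> holds for a suitable \<open>U\<close>; since it mentions no norm, it
  bounds the ratio of diameters for all norms at once.

  The rotation comes from a greedy orthonormal frame. Let \<open>b\<^sub>0\<close> point to a longest vector of \<open>K\<close>,
  project \<open>K\<close> to the orthogonal complement of \<open>b\<^sub>0\<close>, let \<open>b\<^sub>1\<close> point to a longest vector of that
  projection, and so on (\<open>greedy_orthonormal_sequence\<close>). A longest vector of a projection lies on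
  the axis of \<open>b\<^sub>m\<close> and realises the half-width \<open>h\<^sub>m\<close> of \<open>K\<close> in that direction. Hence in the new
  coordinates \<open>h\<^sub>m e\<^sub>m\<close> belongs to the projection of \<open>K\<close> to the coordinates \<open>m, m + 1, \<dots>\<close>, and
  so to \<open>P\<^sub>S K\<close> for every \<open>S\<close> whose first element is \<open>m\<close>.

  Now let \<open>x \<in> Q\<^bsub>k-1\<^esub>(K)\<close>, let \<open>card S = k\<close> and let \<open>m\<close> be the first element of \<open>S\<close>. Some \<open>y \<in> K\<close>
  agrees with \<open>x\<close> on \<open>S - {m}\<close>, so that \<open>P\<^sub>S x = P\<^sub>S y + (x\<^sub>m - y\<^sub>m) e\<^sub>m\<close>. As \<open>k \<ge> 2\<close>, both \<open>x\<^sub>m\<close> and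
  \<open>y\<^sub>m\<close> are at most \<open>h\<^sub>m\<close> in absolute value, so the last summand is in \<open>2 P\<^sub>S K\<close>, and
  \<open>P\<^sub>S x \<in> P\<^sub>S K + 2 P\<^sub>S K = 3 P\<^sub>S K\<close> (\<open>k_convex_hull_scaled\<close>).
\<close>

section \<open>A greedy orthonormal frame of a symmetric compact set\<close>

text \<open>
  Maximising \<open>w \<bullet> x\<close> jointly over unit vectors \<open>w\<close> orthogonal to \<open>B\<close> and points \<open>x \<in> K\<close> finds a
  longest vector of the projection of \<open>K\<close> without mentioning that projection. The last clause
  says that the projection of \<open>z\<close> is a multiple of \<open>w\<close>: a further component \<open>a\<close> in a direction
  \<open>u\<close> would make a vector tilted towards \<open>u\<close> score \<open>sqrt (M\<^sup>2 + a\<^sup>2) > M\<close>.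
\<close>

lemma greedy_direction:
  fixes K :: "'a::euclidean_space set"
  assumes K: "compact K" "K \<noteq> {}" and sym: "\<And>x. x \<in> K \<Longrightarrow> - x \<in> K"
    and B: "dim B < DIM('a)"
  obtains w z where "norm w = 1" "\<forall>b\<in>B. b \<bullet> w = 0"
    "z \<in> K" "\<forall>x\<in>K. \<bar>w \<bullet> x\<bar> \<le> w \<bullet> z"
    "\<forall>u. (\<forall>b\<in>insert w B. b \<bullet> u = 0) \<longrightarrow> u \<bullet> z = 0"
proof -
  define W where "W = {w. norm w = 1 \<and> (\<forall>b\<in>B. b \<bullet> w = 0)}"
  have W_eq: "W = sphere 0 1 \<inter> (\<Inter>b\<in>B. {w. b \<bullet> w = 0})"
    by (auto simp: W_def)
  have "compact W"
    unfolding W_eq by (intro compact_Int_closed compact_sphere closed_INT ballI closed_hyperplane)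
  then have "compact (W \<times> K)"
    using K by (intro compact_Times)
  have unit: "u /\<^sub>R norm u \<in> W" if "u \<noteq> 0" "\<forall>b\<in>B. b \<bullet> u = 0" for u
    using that by (simp add: W_def)
  obtain x where "x \<noteq> 0" "\<And>y. y \<in> span B \<Longrightarrow> orthogonal x y"
    using B orthogonal_to_subspace_exists by blast
  then have "x /\<^sub>R norm x \<in> W"
    by (intro unit) (auto simp: orthogonal_def inner_commute span_base)
  then have "W \<times> K \<noteq> {}"
    using K by auto
  have "continuous_on (W \<times> K) (\<lambda>p. fst p \<bullet> snd p)"
    by (intro continuous_intros)
  then obtain w z where wz: "w \<in> W" "z \<in> K"
    and max: "\<And>v x. v \<in> W \<Longrightarrow> x \<in> K \<Longrightarrow> v \<bullet> x \<le> w \<bullet> z"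
    using continuous_attains_sup[OF \<open>compact (W \<times> K)\<close> \<open>W \<times> K \<noteq> {}\<close>] by fastforce
  show thesis
  proof (rule that)
    show "norm w = 1" and w_B: "\<forall>b\<in>B. b \<bullet> w = 0"
      using wz by (auto simp: W_def)
    show "z \<in> K" by fact
    show abs_le: "\<forall>x\<in>K. \<bar>w \<bullet> x\<bar> \<le> w \<bullet> z"
      using max[OF wz(1)] sym by (fastforce simp: abs_le_iff)
    show "\<forall>u. (\<forall>b\<in>insert w B. b \<bullet> u = 0) \<longrightarrow> u \<bullet> z = 0"
    proof (intro allI impI)
      fix u assume u: "\<forall>b\<in>insert w B. b \<bullet> u = 0"
      define M where "M = w \<bullet> z"
      have "M \<ge> 0"
        using abs_le wz(2) by (force simp: M_def)
      show "u \<bullet> z = 0"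
      proof (cases "u = 0")
        case False
        define v where "v = u /\<^sub>R norm u"
        define a where "a = v \<bullet> z"
        have v: "v \<in> W" "w \<bullet> v = 0"
          using unit[OF False] u by (auto simp: v_def)
        define t where "t = M *\<^sub>R w + a *\<^sub>R v"
        have "t \<bullet> t = M\<^sup>2 + a\<^sup>2"
          using v wz(1) by (simp add: t_def inner_simps inner_commute W_def power2_eq_square norm_eq_1)
        then have norm_t: "norm t = sqrt (M\<^sup>2 + a\<^sup>2)"
          by (simp add: norm_eq_sqrt_inner)
        have t_z: "t \<bullet> z = M\<^sup>2 + a\<^sup>2"
          by (simp add: t_def inner_simps M_def a_def power2_eq_square)
        have "a = 0"
        proof (rule ccontr)
          assume "a \<noteq> 0"
          then have pos: "M\<^sup>2 + a\<^sup>2 > 0"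
            by (simp add: add_nonneg_pos)
          then have "t \<noteq> 0"
            using norm_t by auto
          moreover have "\<forall>b\<in>B. b \<bullet> t = 0"
            using v w_B by (simp add: t_def inner_simps W_def)
          ultimately have "(t /\<^sub>R norm t) \<bullet> z \<le> M"
            using max[OF unit wz(2)] by (simp add: M_def)
          then have "M\<^sup>2 + a\<^sup>2 \<le> M * sqrt (M\<^sup>2 + a\<^sup>2)"
            using pos by (simp add: norm_t t_z field_simps)
          also have "\<dots> = sqrt (M\<^sup>2) * sqrt (M\<^sup>2 + a\<^sup>2)"
            using \<open>M \<ge> 0\<close> by simp
          also have "\<dots> < sqrt (M\<^sup>2 + a\<^sup>2) * sqrt (M\<^sup>2 + a\<^sup>2)"
            using pos \<open>a \<noteq> 0\<close> by (intro mult_strict_right_mono real_sqrt_less_mono) auto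
          finally show False
            using pos by simp
        qed
        then show ?thesis
          using False by (simp add: a_def v_def)
      qed simp
    qed
  qed
qed

text \<open>
  The last clause, over all \<open>u\<close>, places \<open>z\<close> in the span of \<open>b\<^sub>0, \<dots>, b\<^sub>i\<close> while mentioning only
  vectors chosen up to step \<open>i\<close>, so extending the sequence preserves it. Applied to a later \<open>b\<^sub>j\<close>,
  it says that \<open>z\<close> has no component along \<open>b\<^sub>j\<close>.
\<close>

lemma greedy_orthonormal_sequence:
  fixes K :: "'a::euclidean_space set"
  assumes K: "compact K" "K \<noteq> {}" and sym: "\<And>x. x \<in> K \<Longrightarrow> - x \<in> K"
    and "m \<le> DIM('a)"
  shows "\<exists>b :: nat \<Rightarrow> 'a. \<forall>i<m. norm (b i) = 1 \<and> (\<forall>j<i. b j \<bullet> b i = 0) \<and>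
    (\<exists>z\<in>K. (\<forall>x\<in>K. \<bar>b i \<bullet> x\<bar> \<le> b i \<bullet> z) \<and> (\<forall>u. (\<forall>j\<le>i. b j \<bullet> u = 0) \<longrightarrow> u \<bullet> z = 0))"
  using \<open>m \<le> DIM('a)\<close>
proof (induction m)
  case (Suc m)
  then obtain b :: "nat \<Rightarrow> 'a" where b: "\<forall>i<m. norm (b i) = 1 \<and> (\<forall>j<i. b j \<bullet> b i = 0) \<and>
      (\<exists>z\<in>K. (\<forall>x\<in>K. \<bar>b i \<bullet> x\<bar> \<le> b i \<bullet> z) \<and> (\<forall>u. (\<forall>j\<le>i. b j \<bullet> u = 0) \<longrightarrow> u \<bullet> z = 0))"
    by auto
  have "dim (b ` {..<m}) \<le> card (b ` {..<m})"
    by (intro dim_le_card') simp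
  also have "\<dots> \<le> m"
    using card_image_le[of "{..<m}" b] by simp
  finally have dim: "dim (b ` {..<m}) < DIM('a)"
    using Suc.prems by simp
  obtain w z where
    w: "norm w = 1" "\<forall>a\<in>b ` {..<m}. a \<bullet> w = 0"
    and z: "z \<in> K" "\<forall>x\<in>K. \<bar>w \<bullet> x\<bar> \<le> w \<bullet> z"
      "\<forall>u. (\<forall>a\<in>insert w (b ` {..<m}). a \<bullet> u = 0) \<longrightarrow> u \<bullet> z = 0"
    using greedy_direction[OF K sym dim] by blast
  define c where "c = b(m := w)"
  have c: "c i = b i" if "i < m" for i
    using that by (simp add: c_def)
  have [simp]: "c m = w"
    by (simp add: c_def)
  have "norm (c i) = 1 \<and> (\<forall>j<i. c j \<bullet> c i = 0) \<and>
      (\<exists>z\<in>K. (\<forall>x\<in>K. \<bar>c i \<bullet> x\<bar> \<le> c i \<bullet> z) \<and> (\<forall>u. (\<forall>j\<le>i. c j \<bullet> u = 0) \<longrightarrow> u \<bullet> z = 0))"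
    if "i < Suc m" for i
  proof (cases "i < m")
    case True
    then show ?thesis
      using b c by (auto simp: c_def)
  next
    case False
    with that have "i = m" by simp
    moreover have "u \<bullet> z = 0" if u: "\<forall>j\<le>m. c j \<bullet> u = 0" for u
    proof -
      have "w \<bullet> u = 0"
        using u[rule_format, of m] by simp
      moreover have "b j \<bullet> u = 0" if "j < m" for j
        using u[rule_format, of j] c[OF that] that by simp
      ultimately show ?thesis
        using z(3) by auto
    qed
    ultimately show ?thesis
      using w z(1,2) c by (auto intro!: bexI[of _ z])
  qed
  then show ?case
    by blast
qed simp

section \<open>A rotation to coordinates adapted to the body\<close>

text \<open>
  For a symmetric \<open>K\<close> and a linear order of the coordinates given by \<open>r\<close>, this says that \<open>h\<^sub>i e\<^sub>i\<close>,
  where \<open>h\<^sub>i\<close> is the half-width of \<open>K\<close> in direction \<open>e\<^sub>i\<close>, lies in the projection of \<open>K\<close> to \<open>i\<close> and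
  the coordinates after it.
\<close>

definition axis_adapted :: "('n \<Rightarrow> nat) \<Rightarrow> (real ^ 'n) set \<Rightarrow> bool" where
  "axis_adapted r K \<longleftrightarrow> inj r \<and>
     (\<forall>i. \<exists>z\<in>K. (\<forall>x\<in>K. \<bar>x $ i\<bar> \<le> z $ i) \<and> (\<forall>j. r i < r j \<longrightarrow> z $ j = 0))"

text \<open>
  An orthonormal frame only gives an orthogonal matrix. Scaling one row by the determinant, which is
  \<open>1\<close> or \<open>-1\<close>, makes it a rotation.
\<close>

lemma orthonormal_rows_to_rotation:
  fixes f :: "'n::finite \<Rightarrow> real ^ 'n"
  assumes "\<And>i. norm (f i) = 1" "\<And>i j. i \<noteq> j \<Longrightarrow> f i \<bullet> f j = 0"
  obtains s :: "'n \<Rightarrow> real" where "\<And>i. s i = 1 \<or> s i = -1" "rotation_matrix (\<chi> i. s i *\<^sub>R f i)"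
proof -
  define A :: "real ^ 'n ^ 'n" where "A = (\<chi> i. f i)"
  have "orthogonal_matrix A"
    using assms by (simp add: orthogonal_matrix_orthonormal_rows A_def row_def orthogonal_def)
  then have det_A: "det A = 1 \<or> det A = -1"
    by (rule det_orthogonal_matrix)
  fix k :: 'n
  define s where "s i = (if i = k then det A else 1)" for i
  have s: "s i = 1 \<or> s i = -1" for i
    using det_A by (auto simp: s_def)
  have "(\<chi> i. s i *\<^sub>R f i) = (\<chi> i. if i = k then det A *s f i else f i)"
    by (simp add: vec_eq_iff s_def)
  then have "det (\<chi> i. s i *\<^sub>R f i) = det A * det A"
    by (simp add: det_row_mul A_def)
  then have "det (\<chi> i. s i *\<^sub>R f i) = 1"
    using det_A by auto
  moreover have "norm (s i *\<^sub>R f i) = 1" for i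
    using s[of i] assms(1) by auto
  then have "orthogonal_matrix (\<chi> i. s i *\<^sub>R f i)"
    using assms unfolding orthogonal_matrix_orthonormal_rows row_def vec_lambda_beta vec_nth_inverse
    by (simp add: orthogonal_def)
  ultimately have "rotation_matrix (\<chi> i. s i *\<^sub>R f i)"
    by (simp add: rotation_matrix_def)
  with s show thesis
    by (rule that)
qed

lemma exists_rotation_axis_adapted:
  fixes K :: "(real ^ 'n) set"
  assumes K: "compact K" "K \<noteq> {}" and sym: "\<And>x. x \<in> K \<Longrightarrow> - x \<in> K"
  obtains U :: "real ^ 'n ^ 'n" and r where "rotation_matrix U" "axis_adapted r ((*v) U ` K)"
proof -
  obtain b :: "nat \<Rightarrow> real ^ 'n" where b: "\<forall>i<CARD('n). norm (b i) = 1 \<and> (\<forall>j<i. b j \<bullet> b i = 0) \<and>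
      (\<exists>z\<in>K. (\<forall>x\<in>K. \<bar>b i \<bullet> x\<bar> \<le> b i \<bullet> z) \<and> (\<forall>u. (\<forall>j\<le>i. b j \<bullet> u = 0) \<longrightarrow> u \<bullet> z = 0))"
    using greedy_orthonormal_sequence[OF K sym, of "CARD('n)"] by auto
  obtain r :: "'n \<Rightarrow> nat" where r: "bij_betw r UNIV {0..<CARD('n)}"
    using ex_bij_betw_finite_nat[of "UNIV :: 'n set"] by auto
  have "inj r"
    using r by (simp add: bij_betw_def)
  have r_less: "r i < CARD('n)" for i
    using r bij_betwE by fastforce
  have unit: "norm (b (r i)) = 1" for i
    using b r_less by blast
  have orth_less: "b (r i) \<bullet> b (r j) = 0" if "r i < r j" for i j
    using b r_less that by blast
  have orth: "b (r i) \<bullet> b (r j) = 0" if "i \<noteq> j" for i j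
  proof -
    have "r i \<noteq> r j"
      using that \<open>inj r\<close> by (simp add: inj_eq)
    then show ?thesis
      using orth_less[of i j] orth_less[of j i] by (cases "r i < r j") (auto simp: inner_commute)
  qed
  obtain s where s: "\<And>i. s i = 1 \<or> s i = -1" and rot: "rotation_matrix (\<chi> i. s i *\<^sub>R b (r i))"
    using orthonormal_rows_to_rotation[of "\<lambda>i. b (r i)", OF unit orth] by blast
  define U where "U = (\<chi> i. s i *\<^sub>R b (r i))"
  have U_nth: "(U *v x) $ i = s i * (b (r i) \<bullet> x)" for x i
    by (simp add: U_def matrix_vector_mul_component)
  have "\<exists>z\<in>(*v) U ` K. (\<forall>x\<in>(*v) U ` K. \<bar>x $ i\<bar> \<le> z $ i) \<and> (\<forall>j. r i < r j \<longrightarrow> z $ j = 0)" for i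
  proof -
    obtain z where z: "z \<in> K" "\<forall>x\<in>K. \<bar>b (r i) \<bullet> x\<bar> \<le> b (r i) \<bullet> z"
      "\<And>u. \<forall>j\<le>r i. b j \<bullet> u = 0 \<Longrightarrow> u \<bullet> z = 0"
      using b r_less[of i] by blast
    have "b (r j) \<bullet> z = 0" if "r i < r j" for j
      using b r_less[of j] that by (intro z(3)) auto
    moreover have "s i *\<^sub>R z \<in> K"
      using s[of i] z(1) sym by auto
    ultimately show ?thesis
      \<comment> \<open>The factor makes the \<open>i\<close>-th coordinate of the extremal point nonnegative again.\<close>
      using s[of i] z(2) by (intro bexI[of _ "U *v (s i *\<^sub>R z)"]) (auto simp: U_nth abs_mult)
  qed
  then have "axis_adapted r ((*v) U ` K)"
    using \<open>inj r\<close> by (simp add: axis_adapted_def)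
  with rot that show thesis
    by (simp add: U_def)
qed

section \<open>Comparing consecutive hulls\<close>

lemma mem_k_convex_hull_iff:
  "x \<in> k_convex_hull k K \<longleftrightarrow> (\<forall>S. card S = k \<longrightarrow> (\<exists>y\<in>K. \<forall>i\<in>S. x $ i = y $ i))"
proof -
  have "coord_proj S x = coord_proj S y \<longleftrightarrow> (\<forall>i\<in>S. x $ i = y $ i)" for S and y :: "real ^ 'a"
    by (auto simp: coord_proj_eq vec_eq_iff)
  then show ?thesis
    unfolding k_convex_hull_def by (auto simp: image_iff)
qed

lemma k_convex_hull_scaled:
  assumes adapted: "axis_adapted r K" and K: "convex K" and sym: "\<And>x. x \<in> K \<Longrightarrow> - x \<in> K"
    and k: "2 \<le> k" and x: "x \<in> k_convex_hull (k - 1) K"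
  shows "(1/3) *\<^sub>R x \<in> k_convex_hull k K"
  unfolding mem_k_convex_hull_iff
proof (intro allI impI)
  fix S :: "'a set" assume S: "card S = k"
  then have "S \<noteq> {}"
    using k by auto
  then obtain m where m: "m \<in> S" "\<And>i. i \<in> S \<Longrightarrow> r m \<le> r i"
    by (metis arg_min_if_finite(1) arg_min_least finite)
  have first: "r m < r i" if "i \<in> S" "i \<noteq> m" for i
    using m(2)[OF that(1)] adapted that by (auto simp: axis_adapted_def inj_eq order_less_le)
  obtain z where z: "z \<in> K" "\<And>v. v \<in> K \<Longrightarrow> \<bar>v $ m\<bar> \<le> z $ m" "\<And>j. r m < r j \<Longrightarrow> z $ j = 0"
    using adapted by (meson axis_adapted_def)
  have agree: "\<exists>y\<in>K. \<forall>i\<in>S - {l}. x $ i = y $ i" if "l \<in> S" for l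
    using x S that by (simp add: mem_k_convex_hull_iff)
  obtain y where y: "y \<in> K" "\<forall>i\<in>S - {m}. x $ i = y $ i"
    using agree[OF m(1)] by blast
  have x_m: "\<bar>x $ m\<bar> \<le> z $ m"
  proof -
    have "S \<noteq> {m}"
      using S k by auto
    with m(1) obtain l where "l \<in> S" "l \<noteq> m"
      by blast
    then show ?thesis
      using agree[of l] m(1) z(2) by fastforce
  qed
  \<comment> \<open>The multiple of \<open>z\<close> that bridges half of the gap at \<open>m\<close>; it is \<open>0\<close> if \<open>K\<close> is flat there.\<close>
  define t where "t = (x $ m - y $ m) / (2 * z $ m)"
  have gap: "\<bar>x $ m - y $ m\<bar> \<le> 2 * z $ m"
    using x_m z(2)[OF y(1)] by linarith
  then have t: "\<bar>t\<bar> \<le> 1" "2 * t * z $ m = x $ m - y $ m"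
    by (auto simp: t_def divide_le_eq)
  have tz: "t *\<^sub>R z \<in> K"
  proof -
    have "((1 - t) / 2) *\<^sub>R (- z) + ((1 + t) / 2) *\<^sub>R z \<in> K"
      using t(1) by (intro convexD[OF K sym[OF z(1)] z(1)]) (auto simp: field_simps)
    moreover have "((1 - t) / 2) *\<^sub>R (- z) + ((1 + t) / 2) *\<^sub>R z = t *\<^sub>R z"
      by (simp add: vec_eq_iff field_simps)
    ultimately show ?thesis
      by simp
  qed
  have "(1/3) *\<^sub>R y + (2/3) *\<^sub>R (t *\<^sub>R z) \<in> K"
    using convexD[OF K y(1) tz, of "1/3" "2/3"] by simp
  moreover have "((1/3) *\<^sub>R x) $ i = ((1/3) *\<^sub>R y + (2/3) *\<^sub>R (t *\<^sub>R z)) $ i" if "i \<in> S" for i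
    using that t(2) y(2) z(3)[OF first] by (cases "i = m") (auto simp: field_simps)
  ultimately show "\<exists>y\<in>K. \<forall>i\<in>S. ((1/3) *\<^sub>R x) $ i = y $ i"
    by blast
qed

section \<open>Diameters\<close>

lemma subset_k_convex_hull: "K \<subseteq> k_convex_hull k K"
  by (auto simp: mem_k_convex_hull_iff)

lemma bounded_k_convex_hull:
  fixes K :: "(real ^ 'n) set"
  assumes "bounded K" "1 \<le> k" "k \<le> CARD('n)"
  shows "bounded (k_convex_hull k K)"
proof -
  obtain B where B: "\<And>x. x \<in> K \<Longrightarrow> norm x \<le> B"
    using \<open>bounded K\<close> by (auto simp: bounded_iff)
  have "\<bar>x $ i\<bar> \<le> B" if "x \<in> k_convex_hull k K" for x i
  proof -
    obtain S where "{i} \<subseteq> S" "card S = k"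
      using exists_subset_between[of "{i}" k UNIV] assms by auto
    moreover from this that have "\<exists>y\<in>K. \<forall>i\<in>S. x $ i = y $ i"
      by (simp add: mem_k_convex_hull_iff)
    ultimately obtain y where "y \<in> K" "x $ i = y $ i"
      by auto
    then show ?thesis
      using B[of y] component_le_norm_cart[of y i] by simp
  qed
  then have "norm x \<le> (\<Sum>i::'n\<in>UNIV. B)" if "x \<in> k_convex_hull k K" for x
    using that by (intro order_trans[OF norm_le_l1_cart] sum_mono)
  then show ?thesis
    unfolding bounded_iff by blast
qed

lemma is_norm_le_norm:
  fixes N :: "real ^ 'n \<Rightarrow> real"
  assumes "is_norm N"
  obtains C where "C \<ge> 0" "\<And>x. N x \<le> C * norm x"
proof -
  have scale: "N (c *\<^sub>R x) = \<bar>c\<bar> * N x" and nonneg: "0 \<le> N x" and N_0: "N 0 = 0"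
    and add: "N (x + y) \<le> N x + N y" for c x y
    using assms by (auto simp: is_norm_def)
  have N_sum: "N (\<Sum>i\<in>I. g i) \<le> (\<Sum>i\<in>I. N (g i))" if "finite I" for I :: "'n set" and g
    using that
  proof (induction I)
    case (insert i I)
    then show ?case
      using add[of "g i" "\<Sum>i\<in>I. g i"] by simp
  qed (simp add: N_0)
  show thesis
  proof
    show "(\<Sum>i\<in>UNIV. N (axis i 1)) \<ge> 0"
      by (intro sum_nonneg nonneg)
    fix x :: "real ^ 'n"
    have "N x = N (\<Sum>i\<in>UNIV. x $ i *\<^sub>R axis i 1)"
      using basis_expansion[of x] by (simp add: scalar_mult_eq_scaleR)
    also have "\<dots> \<le> (\<Sum>i\<in>UNIV. N (x $ i *\<^sub>R axis i 1))"
      by (rule N_sum) simp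
    also have "\<dots> \<le> (\<Sum>i\<in>UNIV. norm x * N (axis i 1))"
      by (intro sum_mono) (simp add: scale mult_right_mono nonneg component_le_norm_cart)
    finally show "N x \<le> (\<Sum>i\<in>UNIV. N (axis i 1)) * norm x"
      by (simp add: sum_distrib_left mult.commute)
  qed
qed

text \<open>
  The supremum defining the diameter is an upper bound only if the distances are bounded in \<open>N\<close>,
  whereas \<open>bounded A\<close> refers to the Euclidean norm; the comparison of the two norms is what links
  them.
\<close>

lemma norm_diameter_upper:
  assumes N: "is_norm N" and "bounded A" "x \<in> A" "y \<in> A"
  shows "N (x - y) \<le> norm_diameter N A"
proof -
  obtain B where B: "\<And>x. x \<in> A \<Longrightarrow> norm x \<le> B"
    using \<open>bounded A\<close> by (auto simp: bounded_iff)
  obtain C where C: "C \<ge> 0" "\<And>x. N x \<le> C * norm x"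
    using is_norm_le_norm[OF N] by blast
  have "N (u - v) \<le> C * (B + B)" if "u \<in> A" "v \<in> A" for u v
  proof -
    have "norm (u - v) \<le> B + B"
      using norm_triangle_le_diff[of u v] B[OF that(1)] B[OF that(2)] by force
    then show ?thesis
      using C(2)[of "u - v"] mult_left_mono[OF _ C(1)] by (meson order_trans)
  qed
  then have "bdd_above {N (u - v) |u v. u \<in> A \<and> v \<in> A}"
    by (auto simp: bdd_above_def)
  then show ?thesis
    unfolding norm_diameter_def using assms by (intro cSup_upper) auto
qed

lemma norm_diameter_le_scaled:
  assumes N: "is_norm N" and "A \<noteq> {}" "bounded B" and "c > 0"
    and scaled: "\<And>x. x \<in> A \<Longrightarrow> (1/c) *\<^sub>R x \<in> B"
  shows "norm_diameter N A \<le> c * norm_diameter N B"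
  unfolding norm_diameter_def[of N A]
proof (rule cSup_least)
  show "{N (x - y) |x y. x \<in> A \<and> y \<in> A} \<noteq> {}"
    using \<open>A \<noteq> {}\<close> by auto
next
  fix d assume "d \<in> {N (x - y) |x y. x \<in> A \<and> y \<in> A}"
  then obtain x y where xy: "d = N (x - y)" "x \<in> A" "y \<in> A"
    by blast
  have "x - y = c *\<^sub>R ((1/c) *\<^sub>R x - (1/c) *\<^sub>R y)"
    using \<open>c > 0\<close> by (simp add: scaleR_diff_right)
  then have "d = c * N ((1/c) *\<^sub>R x - (1/c) *\<^sub>R y)"
    using N \<open>c > 0\<close> unfolding xy(1) is_norm_def by (metis abs_of_pos)
  also have "\<dots> \<le> c * norm_diameter N B"
    using norm_diameter_upper[OF N \<open>bounded B\<close>] scaled xy \<open>c > 0\<close> by simp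
  finally show "d \<le> c * norm_diameter N B" .
qed

theorem corollary1p3:
  fixes K :: "(real ^ 'n) set"
  assumes "convex_body K" and "symmetric_set K"
  shows "\<exists>U :: real ^ 'n ^ 'n. rotation_matrix U \<and>
    (\<forall>N. is_norm N \<longrightarrow> (\<forall>k\<in>{2..CARD('n)}.
       norm_diameter N (k_convex_hull (k - 1) ((*v) U ` K))
         / norm_diameter N (k_convex_hull k ((*v) U ` K)) \<le> 3))"
proof -
  have K: "compact K" "convex K" "K \<noteq> {}"
    using assms(1) by (auto simp: convex_body_def)
  have sym: "- x \<in> K" if "x \<in> K" for x
    using assms(2) that unfolding symmetric_set_def by blast
  obtain U :: "real ^ 'n ^ 'n" and r where U: "rotation_matrix U"
    and adapted: "axis_adapted r ((*v) U ` K)"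
    using exists_rotation_axis_adapted[OF K(1,3) sym] by blast
  let ?L = "(*v) U ` K"
  have L: "convex ?L" "bounded ?L" "?L \<noteq> {}"
    using K by (auto intro: convex_linear_image bounded_linear_image compact_imp_bounded
        simp: matrix_vector_mul_linear matrix_vector_mul_bounded_linear)
  have L_sym: "- x \<in> ?L" if "x \<in> ?L" for x
    using that sym by (auto simp: image_iff) (metis linear_neg matrix_vector_mul_linear)
  have "norm_diameter N (k_convex_hull (k - 1) ?L) / norm_diameter N (k_convex_hull k ?L) \<le> 3"
    if N: "is_norm N" and k: "k \<in> {2..CARD('n)}" for N k
  proof -
    let ?Q = "k_convex_hull k ?L"
    have Q: "bounded ?Q"
      using bounded_k_convex_hull[OF L(2)] k by simp
    have "k_convex_hull (k - 1) ?L \<noteq> {}"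
      using subset_k_convex_hull L(3) by blast
    then have le: "norm_diameter N (k_convex_hull (k - 1) ?L) \<le> 3 * norm_diameter N ?Q"
      using norm_diameter_le_scaled[OF N _ Q, of _ 3] k_convex_hull_scaled[OF adapted L(1) L_sym] k
      by simp
    obtain x where "x \<in> ?Q"
      using subset_k_convex_hull L(3) by blast
    then have "0 \<le> norm_diameter N ?Q"
      using norm_diameter_upper[OF N Q, of x x] N unfolding is_norm_def by (meson order_trans)
    with le show ?thesis
      by (cases "norm_diameter N ?Q = 0") (auto simp: divide_le_eq)
  qed
  with U show ?thesis
    by blast
qed

end
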